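(* Let $n\in\mathbb N$, let $\mathbf m=(m_1,\overline{\mathbf m})=(m_1,m_2,\ldots,m_k)$ with $k\ge 1$ and $m_i\in\mathbb R\setminus(0,1)$. Then the following identities hold, where $M(\cdot)(n)$ is the (extended and modified) Mellin transform defined in the context, and all constants arising on the right hand sides are finite. (1) For real $a>0$: $$M\!\left(\tfrac{1}{a+x}\right)(n)=\begin{cases}(-a)^n\left(S_1(-\tfrac1a;n)+H_{-a}(1)\right),&0<a<1,\\ (-a)^n\left(S_1(-\tfrac1a;n)-S_1(-\tfrac1a;\infty)\right),&a\ge1.\end{cases}$$ (2) For real $a>0$: $$M\!\left(\tfrac{1}{a-x}\right)(n)=\begin{cases}-S_1(\tfrac1a;n),&0<a\le1,\\ a^n\left(-S_1(\tfrac1a;n)+S_1(\tfrac1a;\infty)\right),&a>1.\end{cases}$$ (3) For real $a>0$: $\displaystyle M\!\left(\tfrac{H_{\mathbf m}(x)}{a+x}\right)(n)=-n\,M(H_{-a,\mathbf m}(x))(n-1)+H_{-a,\mathbf m}(1).$ (4) $\displaystyle M\!\left(\tfrac{H_{\mathbf m}(x)}{1-x}\right)(n)=-n\,M(H_{1,\mathbf m}(x))(n-1).$ (5) For real $a_1>1$: $\displaystyle M\!\left(\tfrac{H_{\mathbf m}(x)}{a_1-x}\right)(n)=-n\,M(H_{a_1,\mathbf m}(x))(n-1)+H_{a_1,\mathbf m}(1).$ (6) For $a_2\in(0,1)$: $$M\!\left(\tfrac{H_{m_1,\overline{\mathbf m}}(x)}{a_2-x}\right)(n)=\begin{cases} -H_{m_1,\overline{\mathbf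 m}}(1)\,S_1(\tfrac1{a_2};n)+\displaystyle\sum_{i=1}^n\frac{a_2^{-i}}{i}\,M\!\left(\tfrac{H_{\overline{\mathbf m}}(x)}{|m_1|+x}\right)(i),&m_1<0,\\[2mm] -H_{0,\overline{\mathbf m}}(1)\,S_1(\tfrac1{a_2};n)+\displaystyle\sum_{i=1}^n\frac{a_2^{-i}}{i}\,M\!\left(\tfrac{H_{\overline{\mathbf m}}(x)}{x}\right)(i),&m_1=0,\\[2mm] \displaystyle\sum_{i=1}^n\frac{a_2^{-i}}{i}\,M\!\left(\tfrac{H_{\overline{\mathbf m}}(x)}{1-x}\right)(i),&m_1=1,\\[2mm] -H_{m_1,\overline{\mathbf m}}(1)\,S_1(\tfrac1{a_2};n)+\displaystyle\sum_{i=1}^n\frac{a_2^{-i}}{i}\,M\!\left(\tfrac{H_{\overline{\mathbf m}}(x)}{m_1-x}\right)(i),&m_1>1. \end{cases}$$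
   Context: $\mathbb N=\{1,2,\dots\}$. $S_1(b;n)=\sum_{i=1}^n\frac{b^i}{i}$ and $S_1(b;\infty)=\lim_{n\to\infty}S_1(b;n)$. Generalized harmonic polylogarithms: for $a\in\mathbb R$ put $f_0(x)=\frac1x$ and $f_a(x)=\frac{1}{|a|-\operatorname{sign}(a)\,x}$ for $a\ne0$. For real $m_1,\dots,m_w$ and $0<x<\min_{m_i>0}m_i$ (no upper bound if no $m_i$ is positive), $H(x)=1$ for the empty index vector, $H_{m_1,\ldots,m_w}(x)=\frac{1}{w!}(\log x)^w$ if all $m_i=0$, and otherwise $H_{m_1,\ldots,m_w}(x)=\int_0^x f_{m_1}(y)H_{m_2,\ldots,m_w}(y)\,dy$. $H_{\mathbf m}(1)$ means $\lim_{x\to1^-}H_{\mathbf m}(x)$. $H_{c,\mathbf m}$ is the polylogarithm with $c$ prepended to the index vector. (Extended and modified) Mellin transform: let $h(x)$ be a generalized polylogarithm with indices in $\mathbb R\setminus(0,1)$ or $h=1$. Then for an integer $n\ge0$ $$M(h(x))(n)=\int_0^1x^nh(x)\,dx,\qquad M\!\left(\tfrac{h(x)}{a+x}\right)(n)=\int_0^1\frac{x^nh(x)}{a+x}\,dx\ \ (a>0),$$ $$M\!\left(\tfrac{h(x)}{a-x}\right)(n)=\int_0^1\frac{x^nh(x)}{a-x}\,dx\ \ (a>1),\qquad M\!\left(\tfrac{h(x)}{a-x}\right)(n)=\int_0^1\frac{\left((x/a)^n-1\right)h(x)}{a-x}\,dx\ \ (0<a\le1),$$ and $M(h(x)/x)(i)=\int_0^1x^{i-1}h(x)\,dx$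 for $i\ge1$. *)

theory Defs
  imports "HOL-Analysis.Analysis"
begin

text \<open>
  All integrals are Henstock--Kurzweil integrals over closed intervals. This covers the (possibly
  improper) integrals over \<open>(0, x)\<close> and \<open>(0, 1)\<close>; junk values at the end points, or at the
  removable singularity \<open>x = a\<close> in the modified Mellin transform, are irrelevant.
\<close>

definition S1 :: "real \<Rightarrow> nat \<Rightarrow> real" where
  "S1 b n = (\<Sum>i = 1..n. b ^ i / real i)"

definition S1_inf :: "real \<Rightarrow> real" where
  "S1_inf b = lim (S1 b)"

definition gpl_kernel :: "real \<Rightarrow> real \<Rightarrow> real" where
  "gpl_kernel a x = (if a = 0 then 1 / x else 1 / (\<bar>a\<bar> - sgn a * x))"

text \<open>
  Generalized harmonic polylogarithms. The value \<open>H ms x\<close> is meaningful only for \<open>0 < x\<close> with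
  \<open>x < c\<close> for every positive index \<open>c\<close> in \<open>ms\<close>.
\<close>

primrec H :: "real list \<Rightarrow> real \<Rightarrow> real" where
  "H [] = (\<lambda>x. 1)"
| "H (m # ms) =
     (if \<forall>c\<in>set (m # ms). c = 0
      then (\<lambda>x. ln x ^ length (m # ms) / fact (length (m # ms)))
      else (\<lambda>x. integral {0..x} (\<lambda>y. gpl_kernel m y * H ms y)))"

definition H_one :: "real list \<Rightarrow> real" where
  "H_one ms = Lim (at_left 1) (H ms)"

text \<open>
  The Mellin transform of \<open>h(x)\<close>, \<open>h(x)/(a + x)\<close>, \<open>h(x)/(a - x)\<close> and \<open>h(x)/x\<close>. The transform of
  \<open>h(x)/(a - x)\<close> depends on the presentation of the function as such a quotient, so the four
  forms get separate constants that take \<open>h\<close> (and \<open>a\<close>) as arguments. The integrands are named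
  so that convergence of the integrals can be stated.
\<close>

definition mellin_fn :: "(real \<Rightarrow> real) \<Rightarrow> nat \<Rightarrow> real \<Rightarrow> real" where
  "mellin_fn h n x = x ^ n * h x"

definition mellin_plus_fn :: "real \<Rightarrow> (real \<Rightarrow> real) \<Rightarrow> nat \<Rightarrow> real \<Rightarrow> real" where
  "mellin_plus_fn a h n x = x ^ n * h x / (a + x)"

definition mellin_minus_fn :: "real \<Rightarrow> (real \<Rightarrow> real) \<Rightarrow> nat \<Rightarrow> real \<Rightarrow> real" where
  "mellin_minus_fn a h n x =
     (if a > 1 then x ^ n * h x / (a - x) else ((x / a) ^ n - 1) * h x / (a - x))"

text \<open>Only for \<open>i \<ge> 1\<close>, where the natural number subtraction does not truncate.\<close>

definition mellin_over_fn :: "(real \<Rightarrow> real) \<Rightarrow> nat \<Rightarrow> real \<Rightarrow> real" where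
  "mellin_over_fn h i x = x ^ (i - 1) * h x"

definition mellin :: "(real \<Rightarrow> real) \<Rightarrow> nat \<Rightarrow> real" where
  "mellin h n = integral {0..1} (mellin_fn h n)"

definition mellin_plus :: "real \<Rightarrow> (real \<Rightarrow> real) \<Rightarrow> nat \<Rightarrow> real" where
  "mellin_plus a h n = integral {0..1} (mellin_plus_fn a h n)"

definition mellin_minus :: "real \<Rightarrow> (real \<Rightarrow> real) \<Rightarrow> nat \<Rightarrow> real" where
  "mellin_minus a h n = integral {0..1} (mellin_minus_fn a h n)"

definition mellin_over :: "(real \<Rightarrow> real) \<Rightarrow> nat \<Rightarrow> real" where
  "mellin_over h i = integral {0..1} (mellin_over_fn h i)"

end

theory Submission
  imports Defs
begin

text \<open>
  Parts (3) to (5) are integration by parts for \<open>x\<^sup>n H_{a,m}(x)\<close>, or for \<open>(x\<^sup>n - 1) H_{1,m}(x)\<close> in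
  part (4), since \<open>H_{a,m}\<close> is a primitive of \<open>f_a H_m\<close>. Convergence and the boundary terms come from
  an induction over the index vector: with \<open>w(x) = (x (1 - x))\<^bsup>-1/2\<^esup>\<close>, every polylogarithm is
  \<open>O(w(x))\<close> on \<open>(0,1)\<close>, and even \<open>O(x w(x))\<close> if some index is nonzero. This is preserved because
  the primitive of \<open>w(x) / (1 - x)\<close> vanishing at \<open>0\<close> is \<open>2 x w(x)\<close>.

  In part (6) the modified kernel is a polynomial, so the left-hand side is a combination of the
  moments \<open>M(H_m)(i - 1)\<close>, and each of them is rewritten by the integration by parts formula for
  the index vector with \<open>m_1\<close> split off. Parts (1) and (2) follow from the recurrence
  \<open>I_{n+1} = m I_n - sgn m / (n + 1)\<close> for \<open>I_n = \<integral>\<^sub>0\<^sup>1 x\<^sup>n f_m(x) dx\<close>; the infinite sums are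
  identified using \<open>I_n \<longlongrightarrow> 0\<close>.
\<close>

section \<open>The arcsine weight, and primitives of functions dominated by it\<close>

text \<open>Up to the factor pi this is the arcsine density on (0,1). Its inverse square root
  singularities absorb powers of the logarithm at 0 and remain integrable at both ends.\<close>

definition weight :: "real \<Rightarrow> real" where
  "weight x = 1 / sqrt (x * (1 - x))"

lemma weight_nonneg: "x \<in> {0<..<1} \<Longrightarrow> weight x \<ge> 0"
  by (simp add: weight_def)

text \<open>The primitive arcsin(2x - 1) is continuous up to both end points, so differentiability
  in the interior suffices although the weight is unbounded there.\<close>

lemma weight_has_integral: "(weight has_integral pi) {0..1}"
proof -
  have "(weight has_integral (arcsin (2 * 1 - 1) - arcsin (2 * 0 - 1))) {0..1}"
  proof (rule fundamental_theorem_of_calculus_interior)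
    show "continuous_on {0..1} (\<lambda>x::real. arcsin (2 * x - 1))"
      by (intro continuous_intros) auto
    fix x :: real assume x: "x \<in> {0<..<1}"
    have "sqrt (1 - (2 * x - 1)\<^sup>2) = sqrt (2\<^sup>2 * (x * (1 - x)))"
      by (simp add: power2_eq_square algebra_simps)
    also have "\<dots> = 2 * sqrt (x * (1 - x))"
      by (simp only: real_sqrt_mult) simp
    finally have sq: "sqrt (1 - (2 * x - 1)\<^sup>2) = 2 * sqrt (x * (1 - x))" .
    have "((\<lambda>x. arcsin (2 * x - 1)) has_real_derivative weight x) (at x)"
      using x by (auto intro!: derivative_eq_intros simp: sq weight_def inverse_eq_divide)
    then show "((\<lambda>x. arcsin (2 * x - 1)) has_vector_derivative weight x) (at x)"
      by (rule has_real_derivative_iff_has_vector_derivative[THEN iffD1])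
  qed simp
  then show ?thesis by simp
qed

lemma x_weight:
  assumes "x \<in> {0<..<1}"
  shows "x * weight x = sqrt (x / (1 - x))"
proof -
  have "x * weight x = (x / sqrt x) / sqrt (1 - x)"
    by (simp add: weight_def real_sqrt_mult)
  also have "x / sqrt x = sqrt x"
    using assms by (simp add: real_div_sqrt)
  finally show ?thesis by (simp add: real_sqrt_divide)
qed

lemma sqrt_ratio_has_real_derivative:
  assumes x: "x \<in> {0<..<1}"
  shows "((\<lambda>x. sqrt (x / (1 - x))) has_real_derivative weight x / (1 - x) / 2) (at x)"
proof -
  define s where "s = sqrt (x / (1 - x))"
  have "s * s = x / (1 - x)" "s > 0" using x by (auto simp: s_def)
  \<comment> \<open>Writing both 1/s and the weight as multiples of s turns the comparison of
    derivatives below into a rational identity.\<close>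
  then have inv: "inverse s = s * (1 - x) / x" using x by (simp add: field_simps)
  have w: "weight x = s / x" using x_weight[OF x] x by (simp add: s_def field_simps)
  have "((\<lambda>x. sqrt (x / (1 - x))) has_real_derivative
      ((1 * (1 - x) - x * (0 - 1)) / ((1 - x) * (1 - x))) * (inverse s / 2)) (at x)"
    unfolding s_def using x by (auto intro!: derivative_eq_intros simp: divide_less_0_iff)
  moreover have "((1 * (1 - x) - x * (0 - 1)) / ((1 - x) * (1 - x))) * (inverse s / 2)
      = weight x / (1 - x) / 2"
    unfolding inv w using x by simp
  ultimately show ?thesis by simp
qed

text \<open>The primitive is twice sqrt(y / (1 - y)), and this square root equals
  \<open>y * weight y\<close> inside the interval. The upper limit stays below 1 because the
  integrand behaves like (1 - y) to the power -3/2 there. One integration thus trades the factor 1 /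
  (1 - y) for a factor y, which is what closes the induction on the index vector.\<close>

lemma sqrt_ratio_has_integral:
  assumes "x \<in> {0<..<1}"
  shows "((\<lambda>y. weight y / (1 - y)) has_integral 2 * (x * weight x)) {0..x}"
proof -
  have "((\<lambda>y. weight y / (1 - y) / 2) has_integral (sqrt (x / (1 - x)) - sqrt (0 / (1 - 0)))) {0..x}"
  proof (rule fundamental_theorem_of_calculus_interior)
    show "continuous_on {0..x} (\<lambda>x. sqrt (x / (1 - x)))"
      using assms by (intro continuous_intros) auto
    fix y assume "y \<in> {0<..<x}"
    then show "((\<lambda>x. sqrt (x / (1 - x))) has_vector_derivative weight y / (1 - y) / 2) (at y)"
      using assms sqrt_ratio_has_real_derivative[of y]
      by (simp add: has_real_derivative_iff_has_vector_derivative)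
  qed (use assms in simp)
  then have "((\<lambda>y. 2 * (weight y / (1 - y) / 2)) has_integral 2 * (x * weight x)) {0..x}"
    using assms by (intro has_integral_mult_right) (simp add: x_weight)
  moreover have "2 * (c / 2) = c" for c :: real by simp
  ultimately show ?thesis by (simp only:)
qed

text \<open>Continuity in the interior gives measurability, and the end points form a null set, so
  arbitrary values of f there do no harm.\<close>

lemma integrable_on_Icc_dominated:
  fixes f g :: "real \<Rightarrow> real"
  assumes "continuous_on {a<..<b} f" "g integrable_on {a..b}"
    and "\<And>x. x \<in> {a<..<b} \<Longrightarrow> \<bar>f x\<bar> \<le> g x"
  shows "f integrable_on {a..b}"
proof -
  have "f integrable_on {a<..<b}"
  proof (rule measurable_bounded_by_integrable_imp_integrable)
    show "f \<in> borel_measurable (lebesgue_on {a<..<b})"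
      by (rule continuous_imp_measurable_on_sets_lebesgue[OF assms(1)]) simp
    show "g integrable_on {a<..<b}"
      using assms(2) by (simp add: integrable_on_Icc_iff_Ioo)
  qed (use assms(3) in auto)
  then show ?thesis by (simp add: integrable_on_Icc_iff_Ioo)
qed

lemma integrable_on_weight_dominated:
  fixes f :: "real \<Rightarrow> real"
  assumes "continuous_on {0<..<1} f" "\<And>x. x \<in> {0<..<1} \<Longrightarrow> \<bar>f x\<bar> \<le> C * weight x"
  shows "f integrable_on {0..1}"
proof (rule integrable_on_Icc_dominated[OF assms(1)])
  show "(\<lambda>x. C * weight x) integrable_on {0..1}"
    using has_integral_mult_right[OF weight_has_integral, of C] by blast
qed (rule assms(2))

text \<open>Here f may blow up at 0 and at 1, and the dominating function is not integrable up to 1.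
  Everything is therefore done on \<open>{0..x}\<close> with x < 1, where the bound integrates
  exactly.\<close>

lemma
  fixes f :: "real \<Rightarrow> real"
  assumes cont: "continuous_on {0<..<1} f"
    and bnd: "\<And>y. y \<in> {0<..<1} \<Longrightarrow> \<bar>f y\<bar> \<le> C * (weight y / (1 - y))"
    and x: "x \<in> {0<..<1}"
  shows primitive_bound: "\<bar>integral {0..x} f\<bar> \<le> 2 * C * (x * weight x)"
    and primitive_has_real_derivative:
      "((\<lambda>x. integral {0..x} f) has_real_derivative f x) (at x)"
proof -
  have dom: "((\<lambda>y. C * (weight y / (1 - y))) has_integral C * (2 * (x * weight x))) {0..x}"
    if "x \<in> {0<..<1}" for x
    by (rule has_integral_mult_right[OF sqrt_ratio_has_integral[OF that]])
  have int: "f integrable_on {0..x}" if x: "x \<in> {0<..<1}" for x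
  proof (rule integrable_on_Icc_dominated)
    show "continuous_on {0<..<x} f"
      using cont by (rule continuous_on_subset) (use x in auto)
    show "(\<lambda>y. C * (weight y / (1 - y))) integrable_on {0..x}"
      using dom[OF x] by blast
  qed (use x bnd in auto)
  \<comment> \<open>The pointwise bound is known only in the interior, hence the passage to the open
    interval.\<close>
  have "norm (integral {0<..<x} f) \<le> integral {0<..<x} (\<lambda>y. C * (weight y / (1 - y)))"
  proof (rule integral_norm_bound_integral)
    show "f integrable_on {0<..<x}"
      using int[OF x] by (simp add: integrable_on_Icc_iff_Ioo)
    show "(\<lambda>y. C * (weight y / (1 - y))) integrable_on {0<..<x}"
      using has_integral_integrable[OF dom[OF x]]
      by (simp add: integrable_on_Icc_iff_Ioo)
  qed (use x bnd in auto)
  then show "\<bar>integral {0..x} f\<bar> \<le> 2 * C * (x * weight x)"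
    using integral_unique[OF dom[OF x]] by (simp add: integral_open_interval_real)
  obtain b where b: "x < b" "b < 1" using x dense by auto
  \<comment> \<open>The differentiation theorem needs continuity on a closed interval, which may
    fail at 0. The base point is moved to a, and the integral over \<open>{0..a}\<close> is a
    constant.\<close>
  define a where "a = x / 2"
  have a: "0 < a" "a < x" using x by (auto simp: a_def)
  have "((\<lambda>u. integral {a..u} f) has_real_derivative f x) (at x within {a..b})"
    by (rule integral_has_real_derivative)
       (use cont a b in \<open>auto intro: continuous_on_subset\<close>)
  then have "((\<lambda>u. integral {0..a} f + integral {a..u} f) has_real_derivative f x) (at x within {a..b})"
    by (auto intro!: derivative_eq_intros)
  then have "((\<lambda>u. integral {0..u} f) has_real_derivative f x) (at x within {a..b})"
  proof (rule has_field_derivative_transform_within[OF _ zero_less_one])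
    show "integral {0..a} f + integral {a..u} f = integral {0..u} f" if "u \<in> {a..b}" for u
      using that a b by (intro Henstock_Kurzweil_Integration.integral_combine int) auto
  qed (use a b in auto)
  then show "((\<lambda>x. integral {0..x} f) has_real_derivative f x) (at x)"
    using a b by (simp add: at_within_Icc_at)
qed

section \<open>Growth of the kernels and polylogarithms on (0,1)\<close>

text \<open>Raise t \<le> exp t with t = - ln x / (2k) to the k-th power: the exponential becomes 1
  / sqrt x, which is below the weight.\<close>

lemma abs_ln_power_le_weight:
  "\<exists>C\<ge>0. \<forall>x\<in>{0<..<1}. \<bar>ln x ^ k\<bar> \<le> C * weight x"
proof (intro exI conjI ballI)
  \<comment> \<open>For k = 0 this constant is 0 ^ 0 = 1, so the witness covers that case as
    well.\<close>
  show "(2 * real k) ^ k \<ge> 0" by simp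
  fix x :: real assume x: "x \<in> {0<..<1}"
  have "\<bar>ln x ^ k\<bar> \<le> (2 * real k) ^ k * exp (- ln x / 2)"
  proof (cases "k = 0")
    case False
    have "- ln x / (2 * real k) \<le> exp (- ln x / (2 * real k))"
      using exp_ge_add_one_self[of "- ln x / (2 * real k)"] by linarith
    then have "- ln x \<le> 2 * real k * exp (- ln x / (2 * real k))"
      using False by (simp add: field_simps)
    then have "(- ln x) ^ k \<le> (2 * real k * exp (- ln x / (2 * real k))) ^ k"
      using x by (intro power_mono) auto
    also have "\<dots> = (2 * real k) ^ k * exp (- ln x / 2)"
      using False by (simp add: power_mult_distrib flip: exp_of_nat_mult)
    finally show ?thesis using x by (simp add: power_abs)
  qed (use x in simp)
  also have "exp (- ln x / 2) = 1 / sqrt x"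
  proof -
    have "exp (- ln x / 2) = inverse (exp (ln (sqrt x)))"
      using x by (simp add: ln_sqrt exp_minus)
    then show ?thesis using x by (simp add: inverse_eq_divide)
  qed
  also have "1 / sqrt x \<le> weight x"
    unfolding weight_def using x by (intro divide_left_mono) (auto simp: mult_le_cancel_left1)
  finally show "\<bar>ln x ^ k\<bar> \<le> (2 * real k) ^ k * weight x"
    by (simp add: mult_left_mono)
qed

text \<open>Among the admissible nonzero indices only m = 1 has its pole at an end of the interval,
  which explains the two grades of bound. The index 0 is left out: its pole at 0 has to be cancelled
  by the polylogarithm it multiplies.\<close>

lemma gpl_kernel_bound:
  assumes "m \<notin> {0<..<1}" "m \<noteq> 0"
  shows "\<exists>K\<ge>0. \<forall>x\<in>{0<..<1}. \<bar>gpl_kernel m x\<bar> \<le> K / (1 - x)"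
    and "m \<noteq> 1 \<Longrightarrow> \<exists>K\<ge>0. \<forall>x\<in>{0<..<1}. \<bar>gpl_kernel m x\<bar> \<le> K"
proof -
  have bounded: "\<exists>K\<ge>0. \<forall>x\<in>{0<..<1}. \<bar>gpl_kernel m x\<bar> \<le> K" if "m \<noteq> 1"
  proof (cases "m < 0")
    case True
    then have "1 / (x - m) \<le> 1 / (- m)" if "x > 0" for x
      using that by (intro divide_left_mono mult_pos_pos) auto
    then show ?thesis
      using True by (intro exI[of _ "1 / (- m)"]) (auto simp: gpl_kernel_def)
  next
    case False
    with assms that have "m > 1" by auto
    then show ?thesis
      by (intro exI[of _ "1 / (m - 1)"])
         (auto simp: gpl_kernel_def intro!: divide_left_mono mult_pos_pos)
  qed
  show "\<exists>K\<ge>0. \<forall>x\<in>{0<..<1}. \<bar>gpl_kernel m x\<bar> \<le> K" if "m \<noteq> 1"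
    by (rule bounded[OF that])
  show "\<exists>K\<ge>0. \<forall>x\<in>{0<..<1}. \<bar>gpl_kernel m x\<bar> \<le> K / (1 - x)"
  proof (cases "m = 1")
    case True
    then show ?thesis by (intro exI[of _ 1]) (auto simp: gpl_kernel_def)
  next
    case False
    then obtain K where K: "K \<ge> 0" "\<forall>x\<in>{0<..<1}. \<bar>gpl_kernel m x\<bar> \<le> K"
      using bounded by blast
    moreover have "K \<le> K / (1 - x)" if "x \<in> {0<..<1}" for x
      using that K(1) by (simp add: field_simps)
    ultimately show ?thesis by (meson order_trans)
  qed
qed

lemma continuous_on_gpl_kernel:
  assumes "m \<notin> {0<..<1}"
  shows "continuous_on {0<..<1} (gpl_kernel m)"
proof -
  have "\<bar>m\<bar> - sgn m * x \<noteq> 0" if "m \<noteq> 0" "x \<in> {0<..<1}" for x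
    using that assms by (cases "m < 0") auto
  then show ?thesis
    unfolding gpl_kernel_def by (cases "m = 0") (auto intro!: continuous_intros)
qed

lemma H_all_zero:
  "\<forall>c\<in>set ms. c = 0 \<Longrightarrow> H ms = (\<lambda>x. ln x ^ length ms / fact (length ms))"
  by (cases ms) auto

lemma H_Cons_not_all_zero:
  "\<exists>c\<in>set (m # ms). c \<noteq> 0 \<Longrightarrow>
    H (m # ms) = (\<lambda>x. integral {0..x} (\<lambda>y. gpl_kernel m y * H ms y))"
  by (simp only: H.simps if_not_P simp_thms bex_simps) (auto simp: fun_eq_iff)

text \<open>If m = 0, some index in \<open>ms\<close> is nonzero, so the sharper bound
  \<open>x * weight x\<close> applies and its factor x cancels the kernel 1/x. If m is nonzero, the
  kernel bound is multiplied with the plain one. The first conclusion feeds the induction; the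
  second gives integrability up to 1 and hence finite values \<open>H_one\<close>.\<close>

lemma integrand_bound:
  assumes m: "m \<notin> {0<..<1}" and nz: "\<exists>c\<in>set (m # ms). c \<noteq> 0"
    and C: "C \<ge> 0" "\<forall>x\<in>{0<..<1}. \<bar>H ms x\<bar> \<le> C * weight x \<and>
          ((\<exists>c\<in>set ms. c \<noteq> 0) \<longrightarrow> \<bar>H ms x\<bar> \<le> C * (x * weight x))"
  shows "\<exists>C\<ge>0. \<forall>x\<in>{0<..<1}. \<bar>gpl_kernel m x * H ms x\<bar> \<le> C * (weight x / (1 - x))"
    and "m \<noteq> 1 \<Longrightarrow> \<exists>C\<ge>0. \<forall>x\<in>{0<..<1}. \<bar>gpl_kernel m x * H ms x\<bar> \<le> C * weight x"
proof -
  have zero: "\<bar>gpl_kernel m x * H ms x\<bar> \<le> C * weight x" if "m = 0" "x \<in> {0<..<1}" for x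
  proof -
    have "\<bar>H ms x\<bar> \<le> C * (x * weight x)" using that nz C by auto
    then show ?thesis using that by (simp add: gpl_kernel_def abs_mult field_simps)
  qed
  show "\<exists>C\<ge>0. \<forall>x\<in>{0<..<1}. \<bar>gpl_kernel m x * H ms x\<bar> \<le> C * weight x" if "m \<noteq> 1"
  proof (cases "m = 0")
    case True
    then show ?thesis using zero C(1) by blast
  next
    case False
    then obtain K where "K \<ge> 0" "\<forall>x\<in>{0<..<1}. \<bar>gpl_kernel m x\<bar> \<le> K"
      using gpl_kernel_bound(2) m \<open>m \<noteq> 1\<close> by blast
    then show ?thesis using C
      by (intro exI[of _ "K * C"])
         (auto simp: abs_mult mult.assoc intro!: mult_mono)
  qed
  show "\<exists>C\<ge>0. \<forall>x\<in>{0<..<1}. \<bar>gpl_kernel m x * H ms x\<bar> \<le> C * (weight x / (1 - x))"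
  proof (cases "m = 0")
    case True
    have "C * weight x \<le> C * (weight x / (1 - x))" if "x \<in> {0<..<1}" for x
      using that C(1) weight_nonneg[OF that]
      by (intro mult_left_mono) (auto simp: field_simps mult_left_le)
    then show ?thesis using zero[OF True] C(1) by (meson order_trans)
  next
    case False
    then obtain K where K: "K \<ge> 0" "\<forall>x\<in>{0<..<1}. \<bar>gpl_kernel m x\<bar> \<le> K / (1 - x)"
      using gpl_kernel_bound(1) m by blast
    have "\<bar>gpl_kernel m x * H ms x\<bar> \<le> K * C * (weight x / (1 - x))" if "x \<in> {0<..<1}" for x
    proof -
      have "\<bar>gpl_kernel m x * H ms x\<bar> \<le> (K / (1 - x)) * (C * weight x)"
        unfolding abs_mult using that C K by (intro mult_mono) auto
      then show ?thesis by simp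
    qed
    then show ?thesis using C(1) K(1) by (intro exI[of _ "K * C"]) auto
  qed
qed

text \<open>The three claims are proved together: continuity makes the next integrand measurable,
  the plain bound controls it, and the sharper bound is needed when 0 is prepended. The sharper
  bound is conditional because powers of the logarithm do not vanish at 0.\<close>

lemma H_growth:
  assumes "\<forall>c\<in>set ms. c \<notin> {0<..<1}"
  shows "continuous_on {0<..<1} (H ms) \<and>
    (\<exists>C\<ge>0. \<forall>x\<in>{0<..<1}. \<bar>H ms x\<bar> \<le> C * weight x \<and>
          ((\<exists>c\<in>set ms. c \<noteq> 0) \<longrightarrow> \<bar>H ms x\<bar> \<le> C * (x * weight x)))"
  using assms
proof (induction ms)
  case Nil
  show ?case using abs_ln_power_le_weight[of 0] by auto
next
  case (Cons m ms)
  then have m: "m \<notin> {0<..<1}" and cont: "continuous_on {0<..<1} (H ms)" by auto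
  obtain C where C: "C \<ge> 0" "\<forall>x\<in>{0<..<1}. \<bar>H ms x\<bar> \<le> C * weight x \<and>
          ((\<exists>c\<in>set ms. c \<noteq> 0) \<longrightarrow> \<bar>H ms x\<bar> \<le> C * (x * weight x))"
    using Cons by auto
  show ?case
  proof (cases "\<forall>c\<in>set (m # ms). c = 0")
    case True
    let ?k = "length (m # ms)"
    obtain D where D: "D \<ge> 0" "\<forall>x\<in>{0<..<1}. \<bar>ln x ^ ?k\<bar> \<le> D * weight x"
      using abs_ln_power_le_weight by blast
    have "\<forall>x\<in>{0<..<1}. \<bar>H (m # ms) x\<bar> \<le> D / fact ?k * weight x"
      unfolding H_all_zero[OF True] using D(2)
      by (auto simp: divide_right_mono simp del: fact_Suc power_Suc)
    moreover have "continuous_on {0<..<1} (H (m # ms))"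
      unfolding H_all_zero[OF True] by (intro continuous_intros) auto
    ultimately show ?thesis using D(1) True
      by (intro conjI exI[of _ "D / fact ?k"]) auto
  next
    case False
    then have nz: "\<exists>c\<in>set (m # ms). c \<noteq> 0" by blast
    obtain D where D: "D \<ge> 0"
      "\<forall>x\<in>{0<..<1}. \<bar>gpl_kernel m x * H ms x\<bar> \<le> D * (weight x / (1 - x))"
      using integrand_bound(1)[OF m nz C] by blast
    have contf: "continuous_on {0<..<1} (\<lambda>y. gpl_kernel m y * H ms y)"
      by (intro continuous_intros continuous_on_gpl_kernel m cont)
    note H = H_Cons_not_all_zero[OF nz]
    have b: "\<bar>H (m # ms) x\<bar> \<le> 2 * D * (x * weight x)" if "x \<in> {0<..<1}" for x
      unfolding H using primitive_bound[OF contf _ that] D(2) by blast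
    have "2 * D * (x * weight x) \<le> 2 * D * weight x" if "x \<in> {0<..<1}" for x
      using that D(1) weight_nonneg[OF that] by (intro mult_left_mono) (auto simp: mult_left_le_one_le)
    with b have b': "\<bar>H (m # ms) x\<bar> \<le> 2 * D * weight x" if "x \<in> {0<..<1}" for x
      using that by (meson order_trans)
    have "continuous_on {0<..<1} (H (m # ms))"
      unfolding H
      by (rule continuous_at_imp_continuous_on)
         (use primitive_has_real_derivative[OF contf] D(2) in \<open>blast intro: DERIV_isCont\<close>)
    then show ?thesis using b b' D(1)
      by (intro conjI exI[of _ "2 * D"]) auto
  qed
qed

lemma continuous_on_H: "\<forall>c\<in>set ms. c \<notin> {0<..<1} \<Longrightarrow> continuous_on {0<..<1} (H ms)"
  using H_growth by blast

lemma H_le_weight: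
  assumes "\<forall>c\<in>set ms. c \<notin> {0<..<1}"
  shows "\<exists>C\<ge>0. \<forall>x\<in>{0<..<1}. \<bar>H ms x\<bar> \<le> C * weight x"
  using H_growth[OF assms] by blast

section \<open>Derivatives and boundary limits of polylogarithms\<close>

text \<open>The logarithmic clause of \<open>H\<close> satisfies the same differential equation as
  the integral clause, so later arguments can treat all index vectors alike.\<close>

lemma H_has_real_derivative:
  assumes adm: "\<forall>c\<in>set (m # ms). c \<notin> {0<..<1}" and x: "x \<in> {0<..<1}"
  shows "(H (m # ms) has_real_derivative gpl_kernel m x * H ms x) (at x)"
proof (cases "\<forall>c\<in>set (m # ms). c = 0")
  case True
  let ?k = "length ms"
  have "((\<lambda>x. ln x ^ Suc ?k / fact (Suc ?k)) has_real_derivative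
      (real (Suc ?k) * ln x ^ ?k * (1 / x)) / fact (Suc ?k)) (at x)"
    using x DERIV_power_Suc[OF DERIV_ln_divide, of x ?k] by (intro DERIV_cdivide) (simp add: mult.commute)
  moreover have "(real (Suc ?k) * ln x ^ ?k * (1 / x)) / fact (Suc ?k) = gpl_kernel m x * H ms x"
    using True x by (simp add: gpl_kernel_def H_all_zero field_simps del: of_nat_Suc)
  ultimately show ?thesis using H_all_zero[OF True] by simp
next
  case False
  then have nz: "\<exists>c\<in>set (m # ms). c \<noteq> 0" by blast
  have adm': "\<forall>c\<in>set ms. c \<notin> {0<..<1}" and m: "m \<notin> {0<..<1}" using adm by auto
  obtain D where D: "D \<ge> 0"
    "\<forall>x\<in>{0<..<1}. \<bar>gpl_kernel m x * H ms x\<bar> \<le> D * (weight x / (1 - x))"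
    using H_growth[OF adm'] integrand_bound(1)[OF m nz] by blast
  show ?thesis
    unfolding H_Cons_not_all_zero[OF nz]
    by (rule primitive_has_real_derivative[OF _ _ x])
       (use D adm' m in \<open>auto intro!: continuous_intros continuous_on_gpl_kernel continuous_on_H\<close>)
qed

lemma eventually_at_right_0_Ioo: "\<forall>\<^sub>F x in at_right (0::real). x \<in> {0<..<1}"
  by (rule eventually_at_right_real) simp

lemma eventually_at_left_1_Ioo: "\<forall>\<^sub>F x in at_left (1::real). x \<in> {0<..<1}"
  by (rule eventually_at_left_real) simp

text \<open>\<open>H_one\<close> is a \<open>Lim\<close>, meaningful only once a limit exists.
  Powers of the logarithm are continuous at 1; otherwise the integrand is dominated by a multiple of
  the weight, so its indefinite integral is continuous up to 1. A leading index 1 is excluded since,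
  for example, - ln(1 - x) diverges.\<close>

lemma H_tendsto_H_one:
  assumes adm: "\<forall>c\<in>set (m # ms). c \<notin> {0<..<1}" and "m \<noteq> 1"
  shows "(H (m # ms) \<longlongrightarrow> H_one (m # ms)) (at_left 1)"
proof -
  have "\<exists>L. (H (m # ms) \<longlongrightarrow> L) (at_left 1)"
  proof (cases "\<forall>c\<in>set (m # ms). c = 0")
    case True
    have "isCont (\<lambda>x::real. ln x ^ length (m # ms) / fact (length (m # ms))) 1"
      by (intro continuous_intros) simp_all
    then have "((\<lambda>x::real. ln x ^ length (m # ms) / fact (length (m # ms))) \<longlongrightarrow>
        ln 1 ^ length (m # ms) / fact (length (m # ms))) (at_left 1)"
      unfolding isCont_def by (rule tendsto_within_subset) simp
    then show ?thesis
      unfolding H_all_zero[OF True] by blast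
  next
    case False
    then have nz: "\<exists>c\<in>set (m # ms). c \<noteq> 0" by blast
    have adm': "\<forall>c\<in>set ms. c \<notin> {0<..<1}" and m: "m \<notin> {0<..<1}" using adm by auto
    let ?f = "\<lambda>x. gpl_kernel m x * H ms x"
    obtain D where D: "\<forall>x\<in>{0<..<1}. \<bar>?f x\<bar> \<le> D * weight x"
      using H_growth[OF adm'] integrand_bound(2)[OF m nz _ _ \<open>m \<noteq> 1\<close>] by blast
    have "?f integrable_on {0..1}"
      by (rule integrable_on_weight_dominated)
         (use D adm' m in \<open>auto intro!: continuous_intros continuous_on_gpl_kernel continuous_on_H\<close>)
    then have "continuous_on {0..1} (\<lambda>x. integral {0..x} ?f)"
      by (rule indefinite_integral_continuous_1)
    then have "((\<lambda>x. integral {0..x} ?f) \<longlongrightarrow> integral {0..1} ?f) (at 1 within {0..1})"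
      by (simp add: continuous_on_def)
    then show ?thesis
      unfolding H_Cons_not_all_zero[OF nz] at_within_Icc_at_left[OF zero_less_one] by (rule exI)
  qed
  then show ?thesis
    unfolding H_one_def by (metis tendsto_Lim trivial_limit_at_left_real)
qed

text \<open>One factor x turns the weight bound into sqrt(x / (1 - x)), which vanishes at 0 even
  when H is a pure power of the logarithm.\<close>

lemma power_times_H_tendsto_0:
  assumes adm: "\<forall>c\<in>set ms. c \<notin> {0<..<1}" and "i \<ge> 1"
  shows "((\<lambda>x. x ^ i * H ms x) \<longlongrightarrow> 0) (at_right 0)"
proof -
  obtain C where C: "C \<ge> 0" "\<forall>x\<in>{0<..<1}. \<bar>H ms x\<bar> \<le> C * weight x"
    using H_le_weight[OF adm] by blast
  have "\<bar>x ^ i * H ms x\<bar> \<le> C * sqrt (x / (1 - x))" if x: "x \<in> {0<..<1}" for x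
  proof -
    have "\<bar>x ^ i\<bar> \<le> x"
      using x \<open>i \<ge> 1\<close> power_decreasing[of 1 i x] by simp
    then have "\<bar>x ^ i * H ms x\<bar> \<le> x * (C * weight x)"
      unfolding abs_mult using x bspec[OF C(2) x] by (intro mult_mono) simp_all
    also have "x * (C * weight x) = C * (x * weight x)" by (rule mult.left_commute)
    finally show ?thesis unfolding x_weight[OF x] .
  qed
  then have "\<forall>\<^sub>F x in at_right 0. norm (x ^ i * H ms x) \<le> C * sqrt (x / (1 - x))"
    by (intro eventually_mono[OF eventually_at_right_0_Ioo]) simp
  moreover have "isCont (\<lambda>x::real. C * sqrt (x / (1 - x))) 0"
    by (intro continuous_intros) simp
  then have "((\<lambda>x. C * sqrt (x / (1 - x))) \<longlongrightarrow> C * sqrt (0 / (1 - 0))) (at_right 0)"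
    unfolding isCont_def by (rule tendsto_within_subset) simp
  then have "((\<lambda>x. C * sqrt (x / (1 - x))) \<longlongrightarrow> 0) (at_right 0)" by simp
  ultimately show ?thesis
    by (rule Lim_null_comparison)
qed

text \<open>Used with leading index 1, where the accompanying factor \<open>x ^ i - 1\<close> does
  not help at 0 and the sharper growth bound must do the work.\<close>

lemma H_tendsto_0_at_right_0:
  assumes adm: "\<forall>c\<in>set ms. c \<notin> {0<..<1}" and nz: "\<exists>c\<in>set ms. c \<noteq> 0"
  shows "(H ms \<longlongrightarrow> 0) (at_right 0)"
proof -
  obtain C where C: "\<And>x. x \<in> {0<..<1} \<Longrightarrow> \<bar>H ms x\<bar> \<le> C * (x * weight x)"
    using H_growth[OF adm] nz by blast
  then have "\<forall>\<^sub>F x in at_right 0. norm (H ms x) \<le> C * sqrt (x / (1 - x))"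
    by (intro eventually_mono[OF eventually_at_right_0_Ioo]) (simp add: x_weight)
  moreover have "isCont (\<lambda>x::real. C * sqrt (x / (1 - x))) 0"
    by (intro continuous_intros) simp
  then have "((\<lambda>x. C * sqrt (x / (1 - x))) \<longlongrightarrow> C * sqrt (0 / (1 - 0))) (at_right 0)"
    unfolding isCont_def by (rule tendsto_within_subset) simp
  then have "((\<lambda>x. C * sqrt (x / (1 - x))) \<longlongrightarrow> 0) (at_right 0)" by simp
  ultimately show ?thesis
    by (rule Lim_null_comparison)
qed

lemma abs_power_minus_1_le:
  fixes x :: real
  assumes "x \<in> {0..1}"
  shows "\<bar>x ^ n - 1\<bar> \<le> real n * (1 - x)"
proof -
  have "x ^ n - 1 = (x - 1) * (\<Sum>i<n. x ^ i)"
    by (rule power_diff_1_eq)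
  then have "\<bar>x ^ n - 1\<bar> = (1 - x) * (\<Sum>i<n. x ^ i)"
    using assms by (simp add: abs_mult sum_nonneg)
  also have "\<dots> \<le> (1 - x) * (\<Sum>i<n. 1)"
    using assms by (intro mult_left_mono sum_mono) (auto intro: power_le_one)
  finally show ?thesis by (simp add: mult.commute)
qed

text \<open>The zero of \<open>x ^ i - 1\<close> at 1 beats the singularity of the weight, so a
  possibly divergent polylogarithm leaves no boundary term.\<close>

lemma power_minus_1_times_H_tendsto_0:
  assumes adm: "\<forall>c\<in>set ms. c \<notin> {0<..<1}"
  shows "((\<lambda>x. (x ^ i - 1) * H ms x) \<longlongrightarrow> 0) (at_left 1)"
proof -
  obtain C where C: "C \<ge> 0" "\<forall>x\<in>{0<..<1}. \<bar>H ms x\<bar> \<le> C * weight x"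
    using H_le_weight[OF adm] by blast
  have "\<bar>(x ^ i - 1) * H ms x\<bar> \<le> real i * C * sqrt ((1 - x) / x)" if x: "x \<in> {0<..<1}" for x
  proof -
    have "\<bar>(x ^ i - 1) * H ms x\<bar> \<le> (real i * (1 - x)) * (C * weight x)"
      unfolding abs_mult using x bspec[OF C(2) x] abs_power_minus_1_le[of x i]
      by (intro mult_mono) auto
    \<comment> \<open>The weight is symmetric under x -> 1 - x, so \<open>x_weight\<close> can be
      used at 1 - x.\<close>
    also have "(real i * (1 - x)) * (C * weight x) = real i * C * ((1 - x) * weight (1 - x))"
      by (simp add: weight_def mult.commute)
    also have "(1 - x) * weight (1 - x) = sqrt ((1 - x) / x)"
      using x_weight[of "1 - x"] x by simp
    finally show ?thesis .
  qed
  then have "\<forall>\<^sub>F x in at_left 1. norm ((x ^ i - 1) * H ms x) \<le> real i * C * sqrt ((1 - x) / x)"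
    by (intro eventually_mono[OF eventually_at_left_1_Ioo]) simp
  moreover have "isCont (\<lambda>x::real. real i * C * sqrt ((1 - x) / x)) 1"
    by (intro continuous_intros) simp
  then have "((\<lambda>x. real i * C * sqrt ((1 - x) / x)) \<longlongrightarrow> real i * C * sqrt ((1 - 1) / 1)) (at_left 1)"
    unfolding isCont_def by (rule tendsto_within_subset) simp
  then have "((\<lambda>x. real i * C * sqrt ((1 - x) / x)) \<longlongrightarrow> 0) (at_left 1)" by simp
  ultimately show ?thesis
    by (rule Lim_null_comparison)
qed

section \<open>Integration by parts for Mellin transforms\<close>

lemma fundamental_theorem_of_calculus_limits:
  fixes F f :: "real \<Rightarrow> real"
  assumes "a < b" and deriv: "\<And>x. x \<in> {a<..<b} \<Longrightarrow> (F has_real_derivative f x) (at x)"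
    and A: "(F \<longlongrightarrow> A) (at_right a)" and B: "(F \<longlongrightarrow> B) (at_left b)"
  shows "(f has_integral (B - A)) {a..b}"
proof -
  \<comment> \<open>The values of F at the end points may be junk; G replaces them by the one-sided
    limits and is thereby continuous on the closed interval.\<close>
  define G where "G x = (if x = a then A else if x = b then B else F x)" for x
  have G: "(G has_real_derivative f x) (at x)" if "x \<in> {a<..<b}" for x
    using deriv[OF that]
    by (rule has_field_derivative_transform_within_open[OF _ open_greaterThanLessThan that])
       (auto simp: G_def)
  have "continuous_on {a..b} G"
  proof (rule continuous_on_IccI)
    have "\<forall>\<^sub>F x in at_right a. F x = G x"
      using eventually_at_right_real[OF \<open>a < b\<close>] by (rule eventually_mono) (auto simp: G_def)
    with A show "(G \<longlongrightarrow> G a) (at_right a)"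
      by (auto simp: G_def intro: Lim_transform_eventually)
    have "\<forall>\<^sub>F x in at_left b. F x = G x"
      using eventually_at_left_real[OF \<open>a < b\<close>] by (rule eventually_mono) (auto simp: G_def)
    with B \<open>a < b\<close> show "(G \<longlongrightarrow> G b) (at_left b)"
      by (auto simp: G_def intro: Lim_transform_eventually)
    show "G \<midarrow>x\<rightarrow> G x" if "a < x" "x < b" for x
      using DERIV_isCont[OF G] that by (simp add: isCont_def)
  qed (rule \<open>a < b\<close>)
  moreover have "(G has_vector_derivative f x) (at x)" if "x \<in> {a<..<b}" for x
    using G[OF that] by (simp add: has_real_derivative_iff_has_vector_derivative)
  ultimately have "(f has_integral (G b - G a)) {a..b}"
    using \<open>a < b\<close> by (intro fundamental_theorem_of_calculus_interior) auto
  then show ?thesis using \<open>a < b\<close> by (simp add: G_def)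
qed

lemma mellin_fn_H_integrable:
  assumes adm: "\<forall>c\<in>set ms. c \<notin> {0<..<1}"
  shows "mellin_fn (H ms) i integrable_on {0..1}"
proof -
  obtain C where C: "C \<ge> 0" "\<forall>x\<in>{0<..<1}. \<bar>H ms x\<bar> \<le> C * weight x"
    using H_le_weight[OF adm] by blast
  have "\<bar>mellin_fn (H ms) i x\<bar> \<le> C * weight x" if x: "x \<in> {0<..<1}" for x
  proof -
    have "\<bar>mellin_fn (H ms) i x\<bar> \<le> 1 * (C * weight x)"
      unfolding abs_mult mellin_fn_def using x bspec[OF C(2) x]
      by (intro mult_mono) (auto simp: power_abs intro: power_le_one)
    then show ?thesis by simp
  qed
  moreover have "continuous_on {0<..<1} (mellin_fn (H ms) i)"
    unfolding mellin_fn_def by (intro continuous_intros continuous_on_H adm)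
  ultimately show ?thesis by (blast intro: integrable_on_weight_dominated)
qed

lemma has_integral_mellin_H:
  assumes "\<forall>c\<in>set ms. c \<notin> {0<..<1}"
  shows "(mellin_fn (H ms) i has_integral mellin (H ms) i) {0..1}"
  using mellin_fn_H_integrable[OF assms] unfolding mellin_def by (rule integrable_integral)

text \<open>The constant d is the freedom in choosing a primitive of i x^(i-1): d = 0 suits a
  leading index other than 1, and d = 1 cancels the singularity at 1 for leading index 1.
  Integrability of the kernel term is a conclusion, obtained by subtracting the moment from the
  integrable total derivative.\<close>

lemma has_integral_by_parts_H:
  assumes adm: "\<forall>c\<in>set (m # ms). c \<notin> {0<..<1}"
    and lim0: "((\<lambda>x. (x ^ i - d) * H (m # ms) x) \<longlongrightarrow> 0) (at_right 0)"
    and lim1: "((\<lambda>x. (x ^ i - d) * H (m # ms) x) \<longlongrightarrow> L) (at_left 1)"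
  shows "((\<lambda>x. (x ^ i - d) * (gpl_kernel m x * H ms x)) has_integral
           - real i * mellin (H (m # ms)) (i - 1) + L) {0..1}"
proof -
  \<comment> \<open>For i = 0 the subtraction i - 1 truncates, but then the factor
    \<open>real i\<close> is zero.\<close>
  let ?u = "\<lambda>x. real i * mellin_fn (H (m # ms)) (i - 1) x"
  let ?v = "\<lambda>x. (x ^ i - d) * (gpl_kernel m x * H ms x)"
  have "((\<lambda>x. (x ^ i - d) * H (m # ms) x) has_real_derivative ?u x + ?v x) (at x)"
    if "x \<in> {0<..<1}" for x
    using H_has_real_derivative[OF adm that]
    by (auto intro!: derivative_eq_intros simp: mellin_fn_def simp del: H.simps)
  from fundamental_theorem_of_calculus_limits[OF zero_less_one this lim0 lim1]
  have "((\<lambda>x. ?u x + ?v x) has_integral L - 0) {0..1}" .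
  from has_integral_diff[OF this has_integral_mult_right[OF has_integral_mellin_H[OF adm], of "real i" "i - 1"]]
  show ?thesis by (simp add: algebra_simps del: H.simps)
qed

text \<open>This is the choice d = 0, serving the kernels 1/(a + x), 1/x and, for a > 1, 1/(a - x)
  at once. The only surviving boundary term is the one at 1.\<close>

lemma has_integral_power_kernel_H:
  assumes adm: "\<forall>c\<in>set (m # ms). c \<notin> {0<..<1}" and "m \<noteq> 1" "i \<ge> 1"
  shows "((\<lambda>x. x ^ i * (gpl_kernel m x * H ms x)) has_integral
           - real i * mellin (H (m # ms)) (i - 1) + H_one (m # ms)) {0..1}"
proof -
  have "((\<lambda>x. x ^ i * H (m # ms) x) \<longlongrightarrow> 1 ^ i * H_one (m # ms)) (at_left 1)"
    by (intro tendsto_intros H_tendsto_H_one adm assms)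
  with has_integral_by_parts_H[OF adm, of i 0] power_times_H_tendsto_0[OF adm \<open>i \<ge> 1\<close>]
  show ?thesis by simp
qed

text \<open>This is the choice d = 1. The value a = 1 lies in the modified branch of
  \<open>mellin_minus_fn\<close>, whose factor is exactly \<open>x ^ i - 1\<close>, and both
  boundary terms vanish.\<close>

lemma mellin_minus_1_H:
  assumes "\<forall>c\<in>set ms. c \<notin> {0<..<1}"
  shows "(mellin_minus_fn 1 (H ms) i has_integral - real i * mellin (H (1 # ms)) (i - 1)) {0..1}"
proof -
  have adm: "\<forall>c\<in>set (1 # ms). c \<notin> {0<..<1}" using assms by simp
  have "((\<lambda>x. (x ^ i - 1) * H (1 # ms) x) \<longlongrightarrow> (0 ^ i - 1) * 0) (at_right 0)"
    by (rule tendsto_mult[OF tendsto_diff[OF tendsto_power[OF tendsto_ident_at] tendsto_const]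
          H_tendsto_0_at_right_0[OF adm]]) simp
  with has_integral_by_parts_H[OF adm, of i 1 0] power_minus_1_times_H_tendsto_0[OF adm, of i]
  have "((\<lambda>x. (x ^ i - 1) * (gpl_kernel 1 x * H ms x)) has_integral
           - real i * mellin (H (1 # ms)) (i - 1)) {0..1}"
    by (simp del: H.simps)
  then show ?thesis
    by (simp add: mellin_minus_fn_def[abs_def] gpl_kernel_def)
qed

lemma mellin_minus_H:
  assumes "\<forall>c\<in>set ms. c \<notin> {0<..<1}" "a > 1" "i \<ge> 1"
  shows "(mellin_minus_fn a (H ms) i has_integral
           - real i * mellin (H (a # ms)) (i - 1) + H_one (a # ms)) {0..1}"
  using has_integral_power_kernel_H[of a ms i] assms
  by (simp add: mellin_minus_fn_def[abs_def] gpl_kernel_def del: H.simps)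

lemma mellin_plus_H:
  assumes "\<forall>c\<in>set ms. c \<notin> {0<..<1}" "a > 0" "i \<ge> 1"
  shows "(mellin_plus_fn a (H ms) i has_integral
           - real i * mellin (H (- a # ms)) (i - 1) + H_one (- a # ms)) {0..1}"
  using has_integral_power_kernel_H[of "- a" ms i] assms
  by (simp add: mellin_plus_fn_def[abs_def] gpl_kernel_def del: H.simps)

lemma mellin_over_H:
  assumes "\<forall>c\<in>set ms. c \<notin> {0<..<1}" "i \<ge> 1"
  shows "(mellin_over_fn (H ms) i has_integral
           - real i * mellin (H (0 # ms)) (i - 1) + H_one (0 # ms)) {0..1}"
\<comment> \<open>At x = 0 the integrands can differ when i = 1, so that point is discarded.\<close>
proof (rule has_integral_spike_finite)
  show "((\<lambda>x. x ^ i * (gpl_kernel 0 x * H ms x)) has_integral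
           - real i * mellin (H (0 # ms)) (i - 1) + H_one (0 # ms)) {0..1}"
    by (rule has_integral_power_kernel_H) (use assms in auto)
  show "mellin_over_fn (H ms) i x = x ^ i * (gpl_kernel 0 x * H ms x)" if "x \<in> {0..1} - {0}" for x
    using that \<open>i \<ge> 1\<close> by (cases i) (auto simp: mellin_over_fn_def gpl_kernel_def)
qed simp

section \<open>The modified kernel as a polynomial\<close>

lemma modified_quotient:
  fixes a x :: real
  assumes "a \<noteq> 0" "x \<noteq> a"
  shows "((x / a) ^ n - 1) / (a - x) = - (\<Sum>i = 1..n. (1 / a) ^ i * x ^ (i - 1))"
proof -
  have "(x / a) ^ n - 1 = (x / a - 1) * (\<Sum>i<n. (x / a) ^ i)"
    by (rule power_diff_1_eq)
  also have "x / a - 1 = - (1 / a) * (a - x)"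
    using assms by (simp add: field_simps)
  finally have "((x / a) ^ n - 1) / (a - x) = - (\<Sum>i<n. (1 / a) * (x / a) ^ i)"
    using assms by (simp add: sum_divide_distrib)
  also have "(\<Sum>i<n. (1 / a) * (x / a) ^ i) = (\<Sum>i = 1..n. (1 / a) ^ i * x ^ (i - 1))"
    by (rule sum.reindex_bij_witness[of _ "\<lambda>i. i - 1" Suc]) (auto simp: power_divide)
  finally show ?thesis .
qed

lemma mellin_minus_modified:
  assumes "0 < a" "a \<le> 1" and h: "\<And>i. mellin_fn h i integrable_on {0..1}"
  shows "(mellin_minus_fn a h n has_integral - (\<Sum>i = 1..n. (1 / a) ^ i * mellin h (i - 1))) {0..1}"
\<comment> \<open>At x = a the quotient is a division by zero with value 0, which need not agree
  with the polynomial; one point does not affect the integral.\<close>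
proof (rule has_integral_spike_finite)
  show "((\<lambda>x. - (\<Sum>i = 1..n. (1 / a) ^ i * mellin_fn h (i - 1) x)) has_integral
          - (\<Sum>i = 1..n. (1 / a) ^ i * mellin h (i - 1))) {0..1}"
    unfolding mellin_def
    by (intro has_integral_neg has_integral_sum has_integral_mult_right integrable_integral h) simp
  fix x assume x: "x \<in> {0..1} - {a}"
  have "mellin_minus_fn a h n x = ((x / a) ^ n - 1) / (a - x) * h x"
    using assms by (simp add: mellin_minus_fn_def)
  also have "\<dots> = - (\<Sum>i = 1..n. (1 / a) ^ i * mellin_fn h (i - 1) x)"
    using assms x
    by (subst modified_quotient) (auto simp: mellin_fn_def sum_distrib_right mult.assoc)
  finally show "mellin_minus_fn a h n x = - (\<Sum>i = 1..n. (1 / a) ^ i * mellin_fn h (i - 1) x)" .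
qed simp

text \<open>Here \<open>T i\<close> stands for the transform, at \<open>i\<close>, of the derivative of \<open>H ms\<close>; integration by parts
  expresses it through \<open>mellin (H ms) (i - 1)\<close>, with boundary term \<open>L\<close>.\<close>

lemma mellin_minus_modified_H:
  assumes adm: "\<forall>c\<in>set ms. c \<notin> {0<..<1}" and a: "0 < a" "a \<le> 1"
    and T: "\<And>i. i \<in> {1..n} \<Longrightarrow> T i = - real i * mellin (H ms) (i - 1) + L"
  shows "mellin_minus a (H ms) n = - L * S1 (1 / a) n + (\<Sum>i = 1..n. (1 / a) ^ i / real i * T i)"
proof -
  have "(\<Sum>i = 1..n. (1 / a) ^ i / real i * T i)
      = (\<Sum>i = 1..n. L * ((1 / a) ^ i / real i) - (1 / a) ^ i * mellin (H ms) (i - 1))"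
  proof (rule sum.cong)
    fix i assume i: "i \<in> {1..n}"
    have "c / real i * (- real i * M + L) = L * (c / real i) - c * M" for c M
      using i by (simp add: field_simps)
    then show "(1 / a) ^ i / real i * T i = L * ((1 / a) ^ i / real i) - (1 / a) ^ i * mellin (H ms) (i - 1)"
      unfolding T[OF i] .
  qed simp
  moreover have "mellin_minus a (H ms) n = - (\<Sum>i = 1..n. (1 / a) ^ i * mellin (H ms) (i - 1))"
    unfolding mellin_minus_def
    by (rule integral_unique) (rule mellin_minus_modified[OF a mellin_fn_H_integrable[OF adm]])
  ultimately show ?thesis
    by (simp add: S1_def sum_subtractf sum_distrib_left sum_negf)
qed

section \<open>Transforms of the bare kernels and the infinite sums\<close>

lemma has_integral_power_Icc01: "((\<lambda>x::real. x ^ n) has_integral 1 / real (Suc n)) {0..1}"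
proof -
  have "((\<lambda>x::real. x ^ n) has_integral (1 ^ Suc n / real (Suc n) - 0 ^ Suc n / real (Suc n))) {0..1}"
  proof (rule fundamental_theorem_of_calculus)
    fix x :: real
    show "((\<lambda>x. x ^ Suc n / real (Suc n)) has_vector_derivative x ^ n) (at x within {0..1})"
      using DERIV_cdivide[OF DERIV_pow[of "Suc n" x "{0..1}"], of "real (Suc n)"]
      by (simp add: has_real_derivative_iff_has_vector_derivative del: of_nat_Suc)
  qed simp
  then show ?thesis by simp
qed

lemma continuous_on_gpl_kernel_Icc:
  assumes "m < 0 \<or> m > 1"
  shows "continuous_on {0..1} (gpl_kernel m)"
  using assms unfolding gpl_kernel_def by (auto intro!: continuous_intros)

lemma H_one_single:
  assumes "m < 0 \<or> m > 1"
  shows "H_one [m] = integral {0..1} (gpl_kernel m)"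
proof -
  have nz: "\<exists>c\<in>set [m]. c \<noteq> 0" using assms by auto
  have "gpl_kernel m integrable_on {0..1}"
    by (rule integrable_continuous_real[OF continuous_on_gpl_kernel_Icc[OF assms]])
  then have "continuous_on {0..1} (\<lambda>x. integral {0..x} (gpl_kernel m))"
    by (rule indefinite_integral_continuous_1)
  then have "((\<lambda>x. integral {0..x} (gpl_kernel m)) \<longlongrightarrow> integral {0..1} (gpl_kernel m)) (at 1 within {0..1})"
    by (simp add: continuous_on_def)
  then have "(H [m] \<longlongrightarrow> integral {0..1} (gpl_kernel m)) (at_left 1)"
    unfolding H_Cons_not_all_zero[OF nz] at_within_Icc_at_left[OF zero_less_one] by simp
  then show ?thesis
    unfolding H_one_def by (rule tendsto_Lim[rotated]) simp
qed

text \<open>From (m - x) f_m(x) = sgn m one gets x f_m = m f_m - sgn m. Multiplying by x^n and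
  integrating gives the recurrence, whose solution starts at H_m(1).\<close>

lemma has_integral_power_kernel:
  assumes m: "m < 0 \<or> m > 1"
  shows "((\<lambda>x. x ^ n * gpl_kernel m x) has_integral
           m ^ n * (H_one [m] - sgn m * S1 (1 / m) n)) {0..1}"
proof (induction n)
  case 0
  show ?case
    using integrable_integral[OF integrable_continuous_real[OF continuous_on_gpl_kernel_Icc[OF m]]]
    by (simp add: H_one_single[OF m] S1_def)
next
  case (Suc n)
  let ?J = "m ^ n * (H_one [m] - sgn m * S1 (1 / m) n)"
  have "((\<lambda>x. m * (x ^ n * gpl_kernel m x) - sgn m * x ^ n) has_integral
      m * ?J - sgn m * (1 / real (Suc n))) {0..1}"
    by (intro has_integral_diff has_integral_mult_right Suc has_integral_power_Icc01)
  moreover have "m * (x ^ n * gpl_kernel m x) - sgn m * x ^ n = x ^ Suc n * gpl_kernel m x"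
    if "x \<in> {0..1}" for x
    using that m by (auto simp: gpl_kernel_def field_simps)
  moreover have "m * ?J - sgn m * (1 / real (Suc n))
      = m ^ Suc n * (H_one [m] - sgn m * S1 (1 / m) (Suc n))"
    using m by (simp add: S1_def field_simps del: of_nat_Suc)
  ultimately show ?case by (metis (no_types, lifting) has_integral_eq)
qed

text \<open>The integrals of x^n f_m are at most K / (n + 1), since the kernel is bounded on the
  closed interval. The closed form then forces the partial sums to converge. The value m = 1, where
  the sums are harmonic numbers, is excluded.\<close>

lemma S1_tendsto:
  assumes m: "m \<le> -1 \<or> m > 1"
  shows "S1 (1 / m) \<longlonglongrightarrow> sgn m * H_one [m]"
proof -
  have m': "m < 0 \<or> m > 1" using m by auto
  let ?I = "\<lambda>n. m ^ n * (H_one [m] - sgn m * S1 (1 / m) n)"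
  obtain K where K: "\<forall>x\<in>{0..1}. \<bar>gpl_kernel m x\<bar> \<le> K"
    using compact_imp_bounded[OF compact_continuous_image[OF continuous_on_gpl_kernel_Icc[OF m'] compact_Icc]]
    by (auto simp: bounded_iff)
  have I: "\<bar>?I n\<bar> \<le> K * (1 / real (Suc n))" for n
  proof -
    have "norm (integral {0..1} (\<lambda>x. x ^ n * gpl_kernel m x)) \<le> integral {0..1} (\<lambda>x. K * x ^ n)"
    proof (rule integral_norm_bound_integral)
      fix x :: real assume "x \<in> {0..1}"
      then show "norm (x ^ n * gpl_kernel m x) \<le> K * x ^ n"
        using mult_right_mono[OF bspec[OF K], of x "x ^ n"] by (simp add: abs_mult power_abs mult.commute)
    qed (use has_integral_power_kernel[OF m'] has_integral_mult_right[OF has_integral_power_Icc01] in blast)+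
    then show ?thesis
      using integral_unique[OF has_integral_power_kernel[OF m', of n]]
        integral_unique[OF has_integral_mult_right[OF has_integral_power_Icc01, of K n]] by simp
  qed
  have "norm (H_one [m] - sgn m * S1 (1 / m) n) \<le> K * (1 / real (Suc n))" for n
  proof -
    \<comment> \<open>Here |m| \<ge> 1 enters: removing the factor m^n can only decrease the
      absolute value.\<close>
    have "1 * \<bar>H_one [m] - sgn m * S1 (1 / m) n\<bar> \<le> \<bar>m ^ n\<bar> * \<bar>H_one [m] - sgn m * S1 (1 / m) n\<bar>"
      using m by (intro mult_right_mono) (auto simp: power_abs intro!: one_le_power)
    with I[of n] show ?thesis by (simp add: abs_mult)
  qed
  then have "\<forall>\<^sub>F n in sequentially. norm (H_one [m] - sgn m * S1 (1 / m) n) \<le> K * (1 / real (Suc n))"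
    by (rule always_eventually[OF allI])
  moreover have "(\<lambda>n. K * (1 / real (Suc n))) \<longlonglongrightarrow> 0"
    using tendsto_mult_right_zero[OF LIMSEQ_inverse_real_of_nat, of K] by (simp add: inverse_eq_divide)
  ultimately have "(\<lambda>n. H_one [m] - sgn m * S1 (1 / m) n) \<longlonglongrightarrow> 0"
    by (rule Lim_null_comparison)
  then have "(\<lambda>n. sgn m * H_one [m] - sgn m * (H_one [m] - sgn m * S1 (1 / m) n)) \<longlonglongrightarrow> sgn m * H_one [m] - sgn m * 0"
    by (intro tendsto_intros)
  moreover have "sgn m * H_one [m] - sgn m * (H_one [m] - sgn m * S1 (1 / m) n) = S1 (1 / m) n" for n
    using m by (auto simp: algebra_simps)
  ultimately show ?thesis by simp
qed

lemma S1_inf_eq: "m \<le> -1 \<or> m > 1 \<Longrightarrow> S1_inf (1 / m) = sgn m * H_one [m]"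
  unfolding S1_inf_def by (rule limI) (rule S1_tendsto)

section \<open>Assembly of the six identities\<close>

theorem lemma7p2:
  fixes n :: nat and m1 :: real and mbar :: "real list"
  assumes "n \<ge> 1"
    and "\<forall>c\<in>set (m1 # mbar). c \<notin> {0<..<1}"
  shows
   "(\<forall>a::real. a > 0 \<longrightarrow>
       mellin_plus_fn a (\<lambda>_. 1) n integrable_on {0..1} \<and>
       (a < 1 \<longrightarrow>
          (H [-a] \<longlongrightarrow> H_one [-a]) (at_left 1) \<and>
          mellin_plus a (\<lambda>_. 1) n = (-a) ^ n * (S1 (- (1 / a)) n + H_one [-a])) \<and>
       (a \<ge> 1 \<longrightarrow>
          S1 (- (1 / a)) \<longlonglongrightarrow> S1_inf (- (1 / a)) \<and>
          mellin_plus a (\<lambda>_. 1) n = (-a) ^ n * (S1 (- (1 / a)) n - S1_inf (- (1 / a))))) \<and>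
    (\<forall>a::real. a > 0 \<longrightarrow>
       mellin_minus_fn a (\<lambda>_. 1) n integrable_on {0..1} \<and>
       (a \<le> 1 \<longrightarrow>
          mellin_minus a (\<lambda>_. 1) n = - S1 (1 / a) n) \<and>
       (a > 1 \<longrightarrow>
          S1 (1 / a) \<longlonglongrightarrow> S1_inf (1 / a) \<and>
          mellin_minus a (\<lambda>_. 1) n = a ^ n * (- S1 (1 / a) n + S1_inf (1 / a)))) \<and>
    (\<forall>a::real. a > 0 \<longrightarrow>
       mellin_plus_fn a (H (m1 # mbar)) n integrable_on {0..1} \<and>
       mellin_fn (H (-a # m1 # mbar)) (n - 1) integrable_on {0..1} \<and>
       (H (-a # m1 # mbar) \<longlongrightarrow> H_one (-a # m1 # mbar)) (at_left 1) \<and>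
       mellin_plus a (H (m1 # mbar)) n =
         - real n * mellin (H (-a # m1 # mbar)) (n - 1) + H_one (-a # m1 # mbar)) \<and>
    (mellin_minus_fn 1 (H (m1 # mbar)) n integrable_on {0..1} \<and>
     mellin_fn (H (1 # m1 # mbar)) (n - 1) integrable_on {0..1} \<and>
     mellin_minus 1 (H (m1 # mbar)) n = - real n * mellin (H (1 # m1 # mbar)) (n - 1)) \<and>
    (\<forall>a1::real. a1 > 1 \<longrightarrow>
       mellin_minus_fn a1 (H (m1 # mbar)) n integrable_on {0..1} \<and>
       mellin_fn (H (a1 # m1 # mbar)) (n - 1) integrable_on {0..1} \<and>
       (H (a1 # m1 # mbar) \<longlongrightarrow> H_one (a1 # m1 # mbar)) (at_left 1) \<and>
       mellin_minus a1 (H (m1 # mbar)) n =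
         - real n * mellin (H (a1 # m1 # mbar)) (n - 1) + H_one (a1 # m1 # mbar)) \<and>
    (\<forall>a2::real. 0 < a2 \<and> a2 < 1 \<longrightarrow>
       mellin_minus_fn a2 (H (m1 # mbar)) n integrable_on {0..1} \<and>
       (m1 < 0 \<longrightarrow>
          (H (m1 # mbar) \<longlongrightarrow> H_one (m1 # mbar)) (at_left 1) \<and>
          (\<forall>i\<in>{1..n}. mellin_plus_fn \<bar>m1\<bar> (H mbar) i integrable_on {0..1}) \<and>
          mellin_minus a2 (H (m1 # mbar)) n =
            - H_one (m1 # mbar) * S1 (1 / a2) n +
            (\<Sum>i = 1..n. (1 / a2) ^ i / real i * mellin_plus \<bar>m1\<bar> (H mbar) i)) \<and>
       (m1 = 0 \<longrightarrow>
          (H (0 # mbar) \<longlongrightarrow> H_one (0 # mbar)) (at_left 1) \<and>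
          (\<forall>i\<in>{1..n}. mellin_over_fn (H mbar) i integrable_on {0..1}) \<and>
          mellin_minus a2 (H (m1 # mbar)) n =
            - H_one (0 # mbar) * S1 (1 / a2) n +
            (\<Sum>i = 1..n. (1 / a2) ^ i / real i * mellin_over (H mbar) i)) \<and>
       (m1 = 1 \<longrightarrow>
          (\<forall>i\<in>{1..n}. mellin_minus_fn 1 (H mbar) i integrable_on {0..1}) \<and>
          mellin_minus a2 (H (m1 # mbar)) n =
            (\<Sum>i = 1..n. (1 / a2) ^ i / real i * mellin_minus 1 (H mbar) i)) \<and>
       (m1 > 1 \<longrightarrow>
          (H (m1 # mbar) \<longlongrightarrow> H_one (m1 # mbar)) (at_left 1) \<and>
          (\<forall>i\<in>{1..n}. mellin_minus_fn m1 (H mbar) i integrable_on {0..1}) \<and>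
          mellin_minus a2 (H (m1 # mbar)) n =
            - H_one (m1 # mbar) * S1 (1 / a2) n +
            (\<Sum>i = 1..n. (1 / a2) ^ i / real i * mellin_minus m1 (H mbar) i)))"
proof -
  have adm: "\<forall>c\<in>set (m1 # mbar). c \<notin> {0<..<1}" by (rule assms(2))
  then have adm': "\<forall>c\<in>set mbar. c \<notin> {0<..<1}" and m1: "m1 \<notin> {0<..<1}" by auto
  have n: "n \<ge> 1" by (rule assms(1))
  have conv: "(H (a # ms) \<longlongrightarrow> H_one (a # ms)) (at_left 1)"
    if "\<forall>c\<in>set (a # ms). c \<notin> {0<..<1}" "a \<noteq> 1" for a ms
    by (rule H_tendsto_H_one[OF that])
  \<comment> \<open>With m = - a the sign is -1, so one formula holds for every a > 0. The case
    split in part (1) only decides whether H_{-a}(1) may be replaced by minus the infinite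
    sum.\<close>
  have plus1: "(mellin_plus_fn a (\<lambda>_. 1) n has_integral
      (- a) ^ n * (S1 (- (1 / a)) n + H_one [- a])) {0..1}" if "a > 0" for a
    using has_integral_power_kernel[of "- a" n] that
    by (simp add: mellin_plus_fn_def[abs_def] gpl_kernel_def add.commute)
  have minus1: "(mellin_minus_fn a (\<lambda>_. 1) n has_integral
      a ^ n * (- S1 (1 / a) n + H_one [a])) {0..1}" if "a > 1" for a
    using has_integral_power_kernel[of a n] that
    by (simp add: mellin_minus_fn_def[abs_def] gpl_kernel_def add.commute)
  have minus1_modified: "(mellin_minus_fn a (\<lambda>_. 1) n has_integral - S1 (1 / a) n) {0..1}"
    if "0 < a" "a \<le> 1" for a
  proof -
    have pow: "(mellin_fn (\<lambda>_. 1) i has_integral 1 / real (Suc i)) {0..1}" for i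
      using has_integral_power_Icc01[of i] by (simp add: mellin_fn_def[abs_def])
    \<comment> \<open>For h = 1 the moments are 1/i, so the polynomial form of the kernel yields the
      partial sum directly.\<close>
    have "mellin (\<lambda>_. 1) (i - 1) = 1 / real i" if "i \<in> {1..n}" for i
      using that integral_unique[OF pow[of "i - 1"]] by (simp add: mellin_def)
    then have "(\<Sum>i = 1..n. (1 / a) ^ i * mellin (\<lambda>_. 1) (i - 1)) = S1 (1 / a) n"
      unfolding S1_def by (intro sum.cong) auto
    moreover have "mellin_fn (\<lambda>_. 1) i integrable_on {0..1}" for i
      using pow by blast
    ultimately show ?thesis
      using mellin_minus_modified[OF that, of "\<lambda>_. 1" n] by simp
  qed
  have part1: "mellin_plus_fn a (\<lambda>_. 1) n integrable_on {0..1} \<and>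
       (a < 1 \<longrightarrow>
          (H [-a] \<longlongrightarrow> H_one [-a]) (at_left 1) \<and>
          mellin_plus a (\<lambda>_. 1) n = (-a) ^ n * (S1 (- (1 / a)) n + H_one [-a])) \<and>
       (a \<ge> 1 \<longrightarrow>
          S1 (- (1 / a)) \<longlonglongrightarrow> S1_inf (- (1 / a)) \<and>
          mellin_plus a (\<lambda>_. 1) n = (-a) ^ n * (S1 (- (1 / a)) n - S1_inf (- (1 / a))))"
    if a: "a > 0" for a
    using plus1[OF a] integral_unique[OF plus1[OF a]] conv[of "- a" "[]"]
      S1_tendsto[of "- a"] S1_inf_eq[of "- a"] a
    by (auto simp: mellin_plus_def simp del: H.simps)
  have part2: "mellin_minus_fn a (\<lambda>_. 1) n integrable_on {0..1} \<and>
       (a \<le> 1 \<longrightarrow>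
          mellin_minus a (\<lambda>_. 1) n = - S1 (1 / a) n) \<and>
       (a > 1 \<longrightarrow>
          S1 (1 / a) \<longlonglongrightarrow> S1_inf (1 / a) \<and>
          mellin_minus a (\<lambda>_. 1) n = a ^ n * (- S1 (1 / a) n + S1_inf (1 / a)))"
    if a: "a > 0" for a
  proof (cases "a \<le> 1")
    case True
    with minus1_modified[OF a True] integral_unique[OF minus1_modified[OF a True]] show ?thesis
      by (auto simp: mellin_minus_def)
  next
    case False
    then have "a > 1" by simp
    from minus1[OF this] integral_unique[OF minus1[OF this]] this S1_tendsto[of a] S1_inf_eq[of a]
    show ?thesis by (auto simp: mellin_minus_def)
  qed
  have part3: "mellin_plus_fn a (H (m1 # mbar)) n integrable_on {0..1} \<and>
       mellin_fn (H (-a # m1 # mbar)) (n - 1) integrable_on {0..1} \<and>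
       (H (-a # m1 # mbar) \<longlongrightarrow> H_one (-a # m1 # mbar)) (at_left 1) \<and>
       mellin_plus a (H (m1 # mbar)) n =
         - real n * mellin (H (-a # m1 # mbar)) (n - 1) + H_one (-a # m1 # mbar)"
    if a: "a > 0" for a
  proof (intro conjI)
    have "\<forall>c\<in>set (- a # m1 # mbar). c \<notin> {0<..<1}" using adm a by auto
    then show "mellin_fn (H (-a # m1 # mbar)) (n - 1) integrable_on {0..1}"
      and "(H (-a # m1 # mbar) \<longlongrightarrow> H_one (-a # m1 # mbar)) (at_left 1)"
      using a by (auto intro!: mellin_fn_H_integrable conv simp del: H.simps)
    note * = mellin_plus_H[OF adm a n]
    show "mellin_plus_fn a (H (m1 # mbar)) n integrable_on {0..1}"
      by (rule has_integral_integrable[OF *])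
    show "mellin_plus a (H (m1 # mbar)) n =
         - real n * mellin (H (-a # m1 # mbar)) (n - 1) + H_one (-a # m1 # mbar)"
      unfolding mellin_plus_def by (rule integral_unique[OF *])
  qed
  have part4: "mellin_minus_fn 1 (H (m1 # mbar)) n integrable_on {0..1} \<and>
     mellin_fn (H (1 # m1 # mbar)) (n - 1) integrable_on {0..1} \<and>
     mellin_minus 1 (H (m1 # mbar)) n = - real n * mellin (H (1 # m1 # mbar)) (n - 1)"
  proof (intro conjI)
    show "mellin_fn (H (1 # m1 # mbar)) (n - 1) integrable_on {0..1}"
      by (rule mellin_fn_H_integrable) (use adm in auto)
    note * = mellin_minus_1_H[OF adm, of n]
    show "mellin_minus_fn 1 (H (m1 # mbar)) n integrable_on {0..1}"
      by (rule has_integral_integrable[OF *])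
    show "mellin_minus 1 (H (m1 # mbar)) n = - real n * mellin (H (1 # m1 # mbar)) (n - 1)"
      unfolding mellin_minus_def by (rule integral_unique[OF *])
  qed
  have part5: "mellin_minus_fn a (H (m1 # mbar)) n integrable_on {0..1} \<and>
       mellin_fn (H (a # m1 # mbar)) (n - 1) integrable_on {0..1} \<and>
       (H (a # m1 # mbar) \<longlongrightarrow> H_one (a # m1 # mbar)) (at_left 1) \<and>
       mellin_minus a (H (m1 # mbar)) n =
         - real n * mellin (H (a # m1 # mbar)) (n - 1) + H_one (a # m1 # mbar)"
    if a: "a > 1" for a
  proof (intro conjI)
    have "\<forall>c\<in>set (a # m1 # mbar). c \<notin> {0<..<1}" using adm a by auto
    then show "mellin_fn (H (a # m1 # mbar)) (n - 1) integrable_on {0..1}"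
      and "(H (a # m1 # mbar) \<longlongrightarrow> H_one (a # m1 # mbar)) (at_left 1)"
      using a by (auto intro!: mellin_fn_H_integrable conv simp del: H.simps)
    note * = mellin_minus_H[OF adm a n]
    show "mellin_minus_fn a (H (m1 # mbar)) n integrable_on {0..1}"
      by (rule has_integral_integrable[OF *])
    show "mellin_minus a (H (m1 # mbar)) n =
         - real n * mellin (H (a # m1 # mbar)) (n - 1) + H_one (a # m1 # mbar)"
      unfolding mellin_minus_def by (rule integral_unique[OF *])
  qed
  have part6: "mellin_minus_fn a (H (m1 # mbar)) n integrable_on {0..1} \<and>
       (m1 < 0 \<longrightarrow>
          (H (m1 # mbar) \<longlongrightarrow> H_one (m1 # mbar)) (at_left 1) \<and>
          (\<forall>i\<in>{1..n}. mellin_plus_fn \<bar>m1\<bar> (H mbar) i integrable_on {0..1}) \<and>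
          mellin_minus a (H (m1 # mbar)) n =
            - H_one (m1 # mbar) * S1 (1 / a) n +
            (\<Sum>i = 1..n. (1 / a) ^ i / real i * mellin_plus \<bar>m1\<bar> (H mbar) i)) \<and>
       (m1 = 0 \<longrightarrow>
          (H (0 # mbar) \<longlongrightarrow> H_one (0 # mbar)) (at_left 1) \<and>
          (\<forall>i\<in>{1..n}. mellin_over_fn (H mbar) i integrable_on {0..1}) \<and>
          mellin_minus a (H (m1 # mbar)) n =
            - H_one (0 # mbar) * S1 (1 / a) n +
            (\<Sum>i = 1..n. (1 / a) ^ i / real i * mellin_over (H mbar) i)) \<and>
       (m1 = 1 \<longrightarrow>
          (\<forall>i\<in>{1..n}. mellin_minus_fn 1 (H mbar) i integrable_on {0..1}) \<and>
          mellin_minus a (H (m1 # mbar)) n =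
            (\<Sum>i = 1..n. (1 / a) ^ i / real i * mellin_minus 1 (H mbar) i)) \<and>
       (m1 > 1 \<longrightarrow>
          (H (m1 # mbar) \<longlongrightarrow> H_one (m1 # mbar)) (at_left 1) \<and>
          (\<forall>i\<in>{1..n}. mellin_minus_fn m1 (H mbar) i integrable_on {0..1}) \<and>
          mellin_minus a (H (m1 # mbar)) n =
            - H_one (m1 # mbar) * S1 (1 / a) n +
            (\<Sum>i = 1..n. (1 / a) ^ i / real i * mellin_minus m1 (H mbar) i))"
    if a: "0 < a" "a < 1" for a
  proof -
    \<comment> \<open>In each case below, \<open>T\<close> becomes the transform of
      \<open>H mbar\<close> against the kernel of \<open>m1\<close>, and \<open>L\<close> the
      boundary value at 1.\<close>
    note mod = mellin_minus_modified_H[OF adm a(1) less_imp_le[OF a(2)]]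
    have int: "mellin_minus_fn a (H (m1 # mbar)) n integrable_on {0..1}"
      using mellin_minus_modified[OF a(1) less_imp_le[OF a(2)] mellin_fn_H_integrable[OF adm]]
      by blast
    consider "m1 < 0" | "m1 = 0" | "m1 = 1" | "m1 > 1" using m1 by fastforce
    then show ?thesis
    proof cases
      case 1
      then have *: "(mellin_plus_fn \<bar>m1\<bar> (H mbar) i has_integral
          - real i * mellin (H (m1 # mbar)) (i - 1) + H_one (m1 # mbar)) {0..1}" if "i \<in> {1..n}" for i
        using mellin_plus_H[OF adm', of "\<bar>m1\<bar>" i] that by (simp del: H.simps)
      then have "mellin_plus \<bar>m1\<bar> (H mbar) i =
          - real i * mellin (H (m1 # mbar)) (i - 1) + H_one (m1 # mbar)" if "i \<in> {1..n}" for i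
        unfolding mellin_plus_def using that by (blast intro: integral_unique)
      from mod[OF this] have "mellin_minus a (H (m1 # mbar)) n =
            - H_one (m1 # mbar) * S1 (1 / a) n +
            (\<Sum>i = 1..n. (1 / a) ^ i / real i * mellin_plus \<bar>m1\<bar> (H mbar) i)" .
      then show ?thesis
        using 1 int conv[OF adm] has_integral_integrable[OF *] by (simp del: H.simps)
    next
      case 2
      then have *: "(mellin_over_fn (H mbar) i has_integral
          - real i * mellin (H (m1 # mbar)) (i - 1) + H_one (m1 # mbar)) {0..1}" if "i \<in> {1..n}" for i
        using mellin_over_H[OF adm', of i] that by (simp del: H.simps)
      then have "mellin_over (H mbar) i =
          - real i * mellin (H (m1 # mbar)) (i - 1) + H_one (m1 # mbar)" if "i \<in> {1..n}" for i
        unfolding mellin_over_def using that by (blast intro: integral_unique)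
      from mod[OF this] have "mellin_minus a (H (m1 # mbar)) n =
            - H_one (m1 # mbar) * S1 (1 / a) n +
            (\<Sum>i = 1..n. (1 / a) ^ i / real i * mellin_over (H mbar) i)" .
      then show ?thesis
        using 2 int conv[OF adm] has_integral_integrable[OF *] by (simp del: H.simps)
    next
      case 3
      then have *: "(mellin_minus_fn 1 (H mbar) i has_integral
          - real i * mellin (H (m1 # mbar)) (i - 1)) {0..1}" for i
        using mellin_minus_1_H[OF adm', of i] by (simp del: H.simps)
      \<comment> \<open>The added 0 makes \<open>L\<close> = 0: for leading index 1 there is no
        boundary term, hence no multiple of \<open>S1\<close> in the result.\<close>
      then have "mellin_minus 1 (H mbar) i =
          - real i * mellin (H (m1 # mbar)) (i - 1) + 0" for i
        using integral_unique[OF *[of i]] by (simp add: mellin_minus_def del: H.simps)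
      from mod[OF this] have "mellin_minus a (H (m1 # mbar)) n =
            (\<Sum>i = 1..n. (1 / a) ^ i / real i * mellin_minus 1 (H mbar) i)"
        by (simp del: H.simps)
      then show ?thesis
        using 3 int has_integral_integrable[OF *] by (simp del: H.simps)
    next
      case 4
      then have *: "(mellin_minus_fn m1 (H mbar) i has_integral
          - real i * mellin (H (m1 # mbar)) (i - 1) + H_one (m1 # mbar)) {0..1}" if "i \<in> {1..n}" for i
        using mellin_minus_H[OF adm', of m1 i] that by (simp del: H.simps)
      then have "mellin_minus m1 (H mbar) i =
          - real i * mellin (H (m1 # mbar)) (i - 1) + H_one (m1 # mbar)" if "i \<in> {1..n}" for i
        unfolding mellin_minus_def using that by (blast intro: integral_unique)
      from mod[OF this] have "mellin_minus a (H (m1 # mbar)) n =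
            - H_one (m1 # mbar) * S1 (1 / a) n +
            (\<Sum>i = 1..n. (1 / a) ^ i / real i * mellin_minus m1 (H mbar) i)" .
      then show ?thesis
        using 4 int conv[OF adm] has_integral_integrable[OF *] by (simp del: H.simps)
    qed
  qed
  show ?thesis
    by (rule conjI, intro allI impI, erule part1,
        rule conjI, intro allI impI, erule part2,
        rule conjI, intro allI impI, erule part3,
        rule conjI, rule part4,
        rule conjI, intro allI impI, erule part5,
        intro allI impI, erule conjE, erule (1) part6)
qed

end
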